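(* Let $\rho,\sigma$ be gauges, let $U\subseteq{}^{\rho}\widetilde{\mathbb R}$, $c\in U$, and $f:U\to{}^{\rho}\widetilde{\mathbb R}$. Then $f$ is sharply continuous at $c$ if and only if it is hyper-sequentially continuous at $c$, i.e. for every hypersequence $(x_n)_n:{}^{\sigma}\widetilde{\mathbb N}\to U$ whose hyperlimit is $c$, the hypersequence $(f(x_n))_n$ has hyperlimit $f(c)$.
   Context: Let $I=(0,1]$. A gauge is a net $\rho=(\rho_\varepsilon)_{\varepsilon\in I}\in(0,1]^I$ with $\rho_\varepsilon\to0$ as $\varepsilon\to0^+$. "$\forall^0\varepsilon:\ P(\varepsilon)$" means: there is $\varepsilon_0\in I$ such that $P(\varepsilon)$ holds for all $\varepsilon\in(0,\varepsilon_0]$. $\mathbb R_\rho$ is the ring of $\rho$-moderate nets: $(x_\varepsilon)\in\mathbb R^I$ with $\exists N\in\mathbb N\,\forall^0\varepsilon:\ |x_\varepsilon|\le\rho_\varepsilon^{-N}$. Write $(x_\varepsilon)\sim_\rho(y_\varepsilon)$ if $\forall n\in\mathbb N\,\forall^0\varepsilon:\ |x_\varepsilon-y_\varepsilon|\le\rho_\varepsilon^n$; a net is $\rho$-negligible if it is $\sim_\rho 0$. ${}^{\rho}\widetilde{\mathbb R}:=\mathbb R_\rho/\sim_\rho$ (a ring with pointwise operations); classes are denoted $[x_\varepsilon]$. Order: $[x_\varepsilon]\le[y_\varepsilon]$ iff there is a $\rho$-negligible $(z_\varepsilon)$ with $\forall^0\varepsilon:\ x_\varepsilon\le y_\varepsilon+z_\varepsilon$;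 $x<y$ means $x\le y$ and $y-x$ is invertible. $|[x_\varepsilon]|:=[|x_\varepsilon|]$, and $\mathrm d\rho:=[\rho_\varepsilon]$. The sharp topology on ${}^{\rho}\widetilde{\mathbb R}$ has as base the balls $B_r(x)=\{y\mid |y-x|<r\}$, $r>0$; "sharply continuous" means continuous with respect to this topology (and the induced one on $U$). Given a gauge $\sigma$, ${}^{\sigma}\widetilde{\mathbb N}:=\{[n_\varepsilon]\in{}^{\sigma}\widetilde{\mathbb R}\mid n_\varepsilon\in\mathbb N\ \forall\varepsilon\}$, ordered by the order $\le$ of ${}^{\sigma}\widetilde{\mathbb R}$. A hypersequence is a map $x:{}^{\sigma}\widetilde{\mathbb N}\to{}^{\rho}\widetilde{\mathbb R}$, $x_n:=x(n)$. An element $l\in{}^{\rho}\widetilde{\mathbb R}$ is the (necessarily unique) hyperlimit of $(x_n)_n$ if $\forall q\in\mathbb N\,\exists M\in{}^{\sigma}\widetilde{\mathbb N}\,\forall n\in{}^{\sigma}\widetilde{\mathbb N},\ n\ge M:\ |x_n-l|<\mathrm d\rho^q$. *)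

theory Defs
  imports "HOL-Analysis.Abstract_Limits" "HOL-Algebra.Ring"
begin

(* A net indexed by (0,1] is a function real => real of which only the values on {0<..1} matter:
   all conditions on nets are "for all sufficiently small positive e", i.e. eventually at_right 0
   (see eventually_small_iff), so two nets that agree on {0<..1} always have the same class. *)

type_synonym net = "real \<Rightarrow> real"

definition is_gauge :: "net \<Rightarrow> bool" where
  "is_gauge \<rho> \<longleftrightarrow> (\<forall>\<epsilon>\<in>{0<..1}. \<rho> \<epsilon> \<in> {0<..1}) \<and> (\<rho> \<longlongrightarrow> 0) (at_right 0)"

definition moderate :: "net \<Rightarrow> net set" where
  "moderate \<rho> = {x. \<exists>N::nat. \<forall>\<^sub>F \<epsilon> in at_right 0. \<bar>x \<epsilon>\<bar> \<le> 1 / \<rho> \<epsilon> ^ N}"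

definition negl :: "net \<Rightarrow> net set" where
  "negl \<rho> = {z. \<forall>n::nat. \<forall>\<^sub>F \<epsilon> in at_right 0. \<bar>z \<epsilon>\<bar> \<le> \<rho> \<epsilon> ^ n}"

definition net_rel :: "net \<Rightarrow> (net \<times> net) set" where
  "net_rel \<rho> = {(x, y). x \<in> moderate \<rho> \<and> y \<in> moderate \<rho> \<and>
                (\<forall>n::nat. \<forall>\<^sub>F \<epsilon> in at_right 0. \<bar>x \<epsilon> - y \<epsilon>\<bar> \<le> \<rho> \<epsilon> ^ n)}"

definition cls :: "net \<Rightarrow> net \<Rightarrow> net set" where
  "cls \<rho> x = net_rel \<rho> `` {x}"

definition RC :: "net \<Rightarrow> net set ring" where
  "RC \<rho> = \<lparr>carrier = moderate \<rho> // net_rel \<rho>,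
            mult = (\<lambda>X Y. \<Union>x\<in>X. \<Union>y\<in>Y. cls \<rho> (\<lambda>\<epsilon>. x \<epsilon> * y \<epsilon>)),
            one = cls \<rho> (\<lambda>\<epsilon>. 1),
            zero = cls \<rho> (\<lambda>\<epsilon>. 0),
            add = (\<lambda>X Y. \<Union>x\<in>X. \<Union>y\<in>Y. cls \<rho> (\<lambda>\<epsilon>. x \<epsilon> + y \<epsilon>))\<rparr>"

(* The choice of representatives is immaterial, see rc_le_cls. *)

definition rc_le :: "net \<Rightarrow> net set \<Rightarrow> net set \<Rightarrow> bool" where
  "rc_le \<rho> X Y \<longleftrightarrow>
     (\<exists>x\<in>X. \<exists>y\<in>Y. \<exists>z\<in>negl \<rho>. \<forall>\<^sub>F \<epsilon> in at_right 0. x \<epsilon> \<le> y \<epsilon> + z \<epsilon>)"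

definition rc_less :: "net \<Rightarrow> net set \<Rightarrow> net set \<Rightarrow> bool" where
  "rc_less \<rho> X Y \<longleftrightarrow> rc_le \<rho> X Y \<and> Y \<ominus>\<^bsub>RC \<rho>\<^esub> X \<in> Units (RC \<rho>)"

definition rc_abs :: "net \<Rightarrow> net set \<Rightarrow> net set" where
  "rc_abs \<rho> X = (\<Union>x\<in>X. cls \<rho> (\<lambda>\<epsilon>. \<bar>x \<epsilon>\<bar>))"

definition drho :: "net \<Rightarrow> net set" where
  "drho \<rho> = cls \<rho> \<rho>"

definition sharp_ball :: "net \<Rightarrow> net set \<Rightarrow> net set \<Rightarrow> net set set" where
  "sharp_ball \<rho> x r = {y \<in> carrier (RC \<rho>). rc_less \<rho> (rc_abs \<rho> (y \<ominus>\<^bsub>RC \<rho>\<^esub> x)) r}"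

definition is_sharp_ball :: "net \<Rightarrow> net set set \<Rightarrow> bool" where
  "is_sharp_ball \<rho> B \<longleftrightarrow> (\<exists>x\<in>carrier (RC \<rho>). \<exists>r\<in>carrier (RC \<rho>).
      rc_less \<rho> \<zero>\<^bsub>RC \<rho>\<^esub> r \<and> B = sharp_ball \<rho> x r)"

(* That unions of balls do form a topology is istopology_sharp below. *)

definition sharp_topology :: "net \<Rightarrow> net set topology" where
  "sharp_topology \<rho> = topology (arbitrary union_of is_sharp_ball \<rho>)"

definition sharply_continuous_at ::
    "net \<Rightarrow> net set set \<Rightarrow> (net set \<Rightarrow> net set) \<Rightarrow> net set \<Rightarrow> bool" where
  "sharply_continuous_at \<rho> U f c \<longleftrightarrow>
     topcontinuous_at (subtopology (sharp_topology \<rho>) U) (sharp_topology \<rho>) f c"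

definition hypernat :: "net \<Rightarrow> net set set" where
  "hypernat \<sigma> = {cls \<sigma> (\<lambda>\<epsilon>. real (n \<epsilon>)) | n. (\<lambda>\<epsilon>. real (n \<epsilon>)) \<in> moderate \<sigma>}"

definition is_hyperlimit ::
    "net \<Rightarrow> net \<Rightarrow> (net set \<Rightarrow> net set) \<Rightarrow> net set \<Rightarrow> bool" where
  "is_hyperlimit \<sigma> \<rho> x l \<longleftrightarrow> l \<in> carrier (RC \<rho>) \<and>
     (\<forall>q::nat. \<exists>M\<in>hypernat \<sigma>. \<forall>n\<in>hypernat \<sigma>. rc_le \<sigma> M n \<longrightarrow>
        rc_less \<rho> (rc_abs \<rho> (x n \<ominus>\<^bsub>RC \<rho>\<^esub> l)) (drho \<rho> [^]\<^bsub>RC \<rho>\<^esub> q))"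

definition hyper_seq_continuous_at ::
    "net \<Rightarrow> net \<Rightarrow> net set set \<Rightarrow> (net set \<Rightarrow> net set) \<Rightarrow> net set \<Rightarrow> bool" where
  "hyper_seq_continuous_at \<sigma> \<rho> U f c \<longleftrightarrow>
     (\<forall>x \<in> hypernat \<sigma> \<rightarrow> U. is_hyperlimit \<sigma> \<rho> x c \<longrightarrow>
        is_hyperlimit \<sigma> \<rho> (\<lambda>n. f (x n)) (f c))"


lemma eventually_small_iff:
  "(\<forall>\<^sub>F \<epsilon> in at_right (0::real). P \<epsilon>) \<longleftrightarrow> (\<exists>\<epsilon>\<^sub>0\<in>{0<..1}. \<forall>\<epsilon>\<in>{0<..\<epsilon>\<^sub>0}. P \<epsilon>)"
proof
  assume "\<forall>\<^sub>F \<epsilon> in at_right (0::real). P \<epsilon>"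
  then obtain b :: real where b: "b > 0" "\<And>y. 0 < y \<Longrightarrow> y < b \<Longrightarrow> P y"
    by (auto simp: eventually_at_right_field)
  then show "\<exists>\<epsilon>\<^sub>0\<in>{0<..1}. \<forall>\<epsilon>\<in>{0<..\<epsilon>\<^sub>0}. P \<epsilon>"
    by (intro bexI[of _ "min 1 (b/2)"]) auto
qed (auto simp: eventually_at_right_field intro: less_imp_le)

lemma gauge_ev: assumes "is_gauge \<rho>" shows "\<forall>\<^sub>F \<epsilon> in at_right 0. 0 < \<rho> \<epsilon> \<and> \<rho> \<epsilon> \<le> 1"
  using assms unfolding is_gauge_def eventually_small_iff by (intro bexI[of _ 1]) auto

lemma gauge_small: assumes "is_gauge \<rho>" "c > 0" shows "\<forall>\<^sub>F \<epsilon> in at_right 0. \<rho> \<epsilon> < c"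
  using assms by (auto simp: is_gauge_def order_tendsto_iff)

lemma moderateE:
  assumes "x \<in> moderate \<rho>"
  obtains N :: nat where "\<forall>\<^sub>F \<epsilon> in at_right 0. \<bar>x \<epsilon>\<bar> \<le> 1 / \<rho> \<epsilon> ^ N"
  using assms by (auto simp: moderate_def)

lemma moderate_common:
  assumes g: "is_gauge \<rho>" and x: "x \<in> moderate \<rho>" and y: "y \<in> moderate \<rho>"
  obtains N :: nat where "\<forall>\<^sub>F \<epsilon> in at_right 0. \<bar>x \<epsilon>\<bar> \<le> 1 / \<rho> \<epsilon> ^ N \<and> \<bar>y \<epsilon>\<bar> \<le> 1 / \<rho> \<epsilon> ^ N"
proof -
  obtain N M :: nat where "\<forall>\<^sub>F \<epsilon> in at_right 0. \<bar>x \<epsilon>\<bar> \<le> 1 / \<rho> \<epsilon> ^ N"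
    "\<forall>\<^sub>F \<epsilon> in at_right 0. \<bar>y \<epsilon>\<bar> \<le> 1 / \<rho> \<epsilon> ^ M" using moderateE[OF x] moderateE[OF y] by metis
  then have "\<forall>\<^sub>F \<epsilon> in at_right 0. \<bar>x \<epsilon>\<bar> \<le> 1 / \<rho> \<epsilon> ^ (N+M) \<and> \<bar>y \<epsilon>\<bar> \<le> 1 / \<rho> \<epsilon> ^ (N+M)"
    using gauge_ev[OF g]
  proof eventually_elim
    case (elim \<epsilon>)
    have "\<rho> \<epsilon> ^ (N+M) \<le> \<rho> \<epsilon> ^ N" "\<rho> \<epsilon> ^ (N+M) \<le> \<rho> \<epsilon> ^ M" "\<rho> \<epsilon> ^ (N+M) > 0"
      using elim by (auto intro!: power_decreasing)
    then have "1 / \<rho> \<epsilon> ^ N \<le> 1 / \<rho> \<epsilon> ^ (N+M)" "1 / \<rho> \<epsilon> ^ M \<le> 1 / \<rho> \<epsilon> ^ (N+M)"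
      using elim by (auto intro!: divide_left_mono)
    then show ?case using elim by linarith
  qed
  then show thesis by (rule that)
qed

lemma moderate_const:
  assumes g: "is_gauge \<rho>" shows "(\<lambda>\<epsilon>. c) \<in> moderate \<rho>"
proof -
  have p: "1 / (\<bar>c\<bar> + 1) > 0" by simp
  have "\<forall>\<^sub>F \<epsilon> in at_right 0. \<bar>c\<bar> \<le> 1 / \<rho> \<epsilon> ^ 1"
    using gauge_ev[OF g] gauge_small[OF g p]
  proof eventually_elim
    case (elim \<epsilon>)
    then have "\<rho> \<epsilon> * (\<bar>c\<bar> + 1) < 1" by (simp add: pos_less_divide_eq)
    then have "\<bar>c\<bar> * \<rho> \<epsilon> \<le> 1" using elim by (simp add: distrib_left mult.commute)
    then show ?case using elim by (simp add: pos_le_divide_eq)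
  qed
  then show ?thesis unfolding moderate_def by blast
qed

lemma moderate_add:
  assumes g: "is_gauge \<rho>" and x: "x \<in> moderate \<rho>" and y: "y \<in> moderate \<rho>"
  shows "(\<lambda>\<epsilon>. x \<epsilon> + y \<epsilon>) \<in> moderate \<rho>"
proof -
  obtain N :: nat where N: "\<forall>\<^sub>F \<epsilon> in at_right 0. \<bar>x \<epsilon>\<bar> \<le> 1 / \<rho> \<epsilon> ^ N \<and> \<bar>y \<epsilon>\<bar> \<le> 1 / \<rho> \<epsilon> ^ N"
    using moderate_common[OF g x y] .
  have "\<forall>\<^sub>F \<epsilon> in at_right 0. \<bar>x \<epsilon> + y \<epsilon>\<bar> \<le> 1 / \<rho> \<epsilon> ^ Suc N"
    using N gauge_ev[OF g] gauge_small[OF g, of "1/2", simplified]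
  proof eventually_elim
    case (elim \<epsilon>)
    have "2 * (1 / \<rho> \<epsilon> ^ N) \<le> 1 / \<rho> \<epsilon> * (1 / \<rho> \<epsilon> ^ N)"
      using elim by (intro mult_right_mono) (auto simp: field_simps)
    then show ?case using elim by auto
  qed
  then show ?thesis unfolding moderate_def by blast
qed

lemma moderate_mult:
  assumes g: "is_gauge \<rho>" and x: "x \<in> moderate \<rho>" and y: "y \<in> moderate \<rho>"
  shows "(\<lambda>\<epsilon>. x \<epsilon> * y \<epsilon>) \<in> moderate \<rho>"
proof -
  obtain N :: nat where N: "\<forall>\<^sub>F \<epsilon> in at_right 0. \<bar>x \<epsilon>\<bar> \<le> 1 / \<rho> \<epsilon> ^ N \<and> \<bar>y \<epsilon>\<bar> \<le> 1 / \<rho> \<epsilon> ^ N"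
    using moderate_common[OF g x y] .
  have "\<forall>\<^sub>F \<epsilon> in at_right 0. \<bar>x \<epsilon> * y \<epsilon>\<bar> \<le> 1 / \<rho> \<epsilon> ^ (N+N)"
    using N gauge_ev[OF g]
  proof eventually_elim
    case (elim \<epsilon>)
    have "\<bar>x \<epsilon>\<bar> * \<bar>y \<epsilon>\<bar> \<le> (1 / \<rho> \<epsilon> ^ N) * (1 / \<rho> \<epsilon> ^ N)"
      using elim by (intro mult_mono) auto
    then show ?case by (simp add: power_add abs_mult)
  qed
  then show ?thesis unfolding moderate_def by blast
qed

lemma moderate_abs: "x \<in> moderate \<rho> \<Longrightarrow> (\<lambda>\<epsilon>. \<bar>x \<epsilon>\<bar>) \<in> moderate \<rho>"
  and moderate_minus: "x \<in> moderate \<rho> \<Longrightarrow> (\<lambda>\<epsilon>. - x \<epsilon>) \<in> moderate \<rho>"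
  by (auto simp: moderate_def)

lemma moderate_diff:
  assumes "is_gauge \<rho>" "x \<in> moderate \<rho>" "y \<in> moderate \<rho>"
  shows "(\<lambda>\<epsilon>. x \<epsilon> - y \<epsilon>) \<in> moderate \<rho>"
  using moderate_add[OF assms(1,2) moderate_minus[OF assms(3)]] by simp

lemma negl_moderate: assumes g: "is_gauge \<rho>" and "z \<in> negl \<rho>" shows "z \<in> moderate \<rho>"
proof -
  have "\<forall>\<^sub>F \<epsilon> in at_right 0. \<bar>z \<epsilon>\<bar> \<le> \<rho> \<epsilon> ^ 0" using assms(2) unfolding negl_def by blast
  then show ?thesis unfolding moderate_def by (auto intro!: exI[of _ 0])
qed

lemma negl_zero: "is_gauge \<rho> \<Longrightarrow> (\<lambda>\<epsilon>. 0) \<in> negl \<rho>"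
  unfolding negl_def by (auto elim!: eventually_mono dest: gauge_ev)

lemma negl_minus: "z \<in> negl \<rho> \<Longrightarrow> (\<lambda>\<epsilon>. - z \<epsilon>) \<in> negl \<rho>"
  by (simp add: negl_def)

lemma negl_mono:
  assumes "z \<in> negl \<rho>" "\<forall>\<^sub>F \<epsilon> in at_right 0. \<bar>w \<epsilon>\<bar> \<le> \<bar>z \<epsilon>\<bar>" shows "w \<in> negl \<rho>"
  unfolding negl_def
proof (intro CollectI allI)
  fix n
  have "\<forall>\<^sub>F \<epsilon> in at_right 0. \<bar>z \<epsilon>\<bar> \<le> \<rho> \<epsilon> ^ n" using assms(1) by (simp add: negl_def)
  then show "\<forall>\<^sub>F \<epsilon> in at_right 0. \<bar>w \<epsilon>\<bar> \<le> \<rho> \<epsilon> ^ n"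
    using assms(2) by eventually_elim auto
qed

lemma negl_add:
  assumes g: "is_gauge \<rho>" and x: "x \<in> negl \<rho>" and y: "y \<in> negl \<rho>"
  shows "(\<lambda>\<epsilon>. x \<epsilon> + y \<epsilon>) \<in> negl \<rho>"
  unfolding negl_def
proof (intro CollectI allI)
  fix n
  have "\<forall>\<^sub>F \<epsilon> in at_right 0. \<bar>x \<epsilon>\<bar> \<le> \<rho> \<epsilon> ^ Suc n" "\<forall>\<^sub>F \<epsilon> in at_right 0. \<bar>y \<epsilon>\<bar> \<le> \<rho> \<epsilon> ^ Suc n"
    using x y unfolding negl_def by blast+
  then show "\<forall>\<^sub>F \<epsilon> in at_right 0. \<bar>x \<epsilon> + y \<epsilon>\<bar> \<le> \<rho> \<epsilon> ^ n"
    using gauge_ev[OF g] gauge_small[OF g, of "1/2", simplified]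
  proof eventually_elim
    case (elim \<epsilon>)
    have "\<rho> \<epsilon> * \<rho> \<epsilon> ^ n \<le> 1/2 * \<rho> \<epsilon> ^ n" using elim by (intro mult_right_mono) auto
    then show ?case using elim abs_triangle_ineq[of "x \<epsilon>" "y \<epsilon>"] unfolding power_Suc by linarith
  qed
qed

lemma negl_mult:
  assumes g: "is_gauge \<rho>" and x: "x \<in> negl \<rho>" and y: "y \<in> moderate \<rho>"
  shows "(\<lambda>\<epsilon>. x \<epsilon> * y \<epsilon>) \<in> negl \<rho>"
  unfolding negl_def
proof (intro CollectI allI)
  fix n
  obtain N :: nat where N: "\<forall>\<^sub>F \<epsilon> in at_right 0. \<bar>y \<epsilon>\<bar> \<le> 1 / \<rho> \<epsilon> ^ N" using moderateE[OF y] .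
  have "\<forall>\<^sub>F \<epsilon> in at_right 0. \<bar>x \<epsilon>\<bar> \<le> \<rho> \<epsilon> ^ (n + N)" using x unfolding negl_def by blast
  then show "\<forall>\<^sub>F \<epsilon> in at_right 0. \<bar>x \<epsilon> * y \<epsilon>\<bar> \<le> \<rho> \<epsilon> ^ n"
    using N gauge_ev[OF g]
  proof eventually_elim
    case (elim \<epsilon>)
    have "\<bar>x \<epsilon>\<bar> * \<bar>y \<epsilon>\<bar> \<le> \<rho> \<epsilon> ^ (n + N) * (1 / \<rho> \<epsilon> ^ N)"
      using elim by (intro mult_mono) auto
    also have "\<dots> = \<rho> \<epsilon> ^ n" using elim by (simp add: power_add)
    finally show ?case by (simp add: abs_mult)
  qed
qed

lemma net_rel_iff: "(x, y) \<in> net_rel \<rho> \<longleftrightarrow>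
    x \<in> moderate \<rho> \<and> y \<in> moderate \<rho> \<and> (\<lambda>\<epsilon>. x \<epsilon> - y \<epsilon>) \<in> negl \<rho>"
  by (auto simp: net_rel_def negl_def)

lemma equiv_net_rel:
  assumes g: "is_gauge \<rho>" shows "equiv (moderate \<rho>) (net_rel \<rho>)"
proof (rule equivI)
  show "net_rel \<rho> \<subseteq> moderate \<rho> \<times> moderate \<rho>" by (auto simp: net_rel_iff)
  show "refl_on (moderate \<rho>) (net_rel \<rho>)"
    by (auto simp: refl_on_def net_rel_iff negl_zero[OF g])
  show "sym (net_rel \<rho>)"
    by (rule symI) (auto simp: net_rel_iff dest: negl_minus)
  show "trans (net_rel \<rho>)"
    by (rule transI) (auto simp: net_rel_iff dest: negl_add[OF g])
qed

lemma cls_eq_iff: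
  assumes "is_gauge \<rho>" "x \<in> moderate \<rho>" "y \<in> moderate \<rho>"
  shows "cls \<rho> x = cls \<rho> y \<longleftrightarrow> (\<lambda>\<epsilon>. x \<epsilon> - y \<epsilon>) \<in> negl \<rho>"
  using eq_equiv_class_iff[OF equiv_net_rel[OF assms(1)] assms(2,3)] assms
  by (auto simp: cls_def net_rel_iff)

lemma cls_eqI: "is_gauge \<rho> \<Longrightarrow> (x, y) \<in> net_rel \<rho> \<Longrightarrow> cls \<rho> x = cls \<rho> y"
  using cls_eq_iff net_rel_iff by blast

lemma cls_in_carrier: "x \<in> moderate \<rho> \<Longrightarrow> cls \<rho> x \<in> carrier (RC \<rho>)"
  by (simp add: RC_def cls_def quotientI)

lemma carrierE:
  assumes "X \<in> carrier (RC \<rho>)" obtains x where "x \<in> moderate \<rho>" "X = cls \<rho> x"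
  using assms by (auto simp: RC_def cls_def elim: quotientE)

lemma rc_zero: "\<zero>\<^bsub>RC \<rho>\<^esub> = cls \<rho> (\<lambda>\<epsilon>. 0)" and rc_one: "\<one>\<^bsub>RC \<rho>\<^esub> = cls \<rho> (\<lambda>\<epsilon>. 1)"
  by (simp_all add: RC_def)

lemma rc_add:
  assumes g: "is_gauge \<rho>" and "x \<in> moderate \<rho>" "y \<in> moderate \<rho>"
  shows "cls \<rho> x \<oplus>\<^bsub>RC \<rho>\<^esub> cls \<rho> y = cls \<rho> (\<lambda>\<epsilon>. x \<epsilon> + y \<epsilon>)"
proof -
  have "congruent2 (net_rel \<rho>) (net_rel \<rho>) (\<lambda>x y. cls \<rho> (\<lambda>\<epsilon>. x \<epsilon> + y \<epsilon>))"
  proof (rule congruent2I')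
    fix y1 z1 y2 z2 assume a: "(y1, z1) \<in> net_rel \<rho>" "(y2, z2) \<in> net_rel \<rho>"
    have "(\<lambda>\<epsilon>. (y1 \<epsilon> - z1 \<epsilon>) + (y2 \<epsilon> - z2 \<epsilon>)) \<in> negl \<rho>"
      using a by (intro negl_add[OF g]) (auto simp: net_rel_iff)
    then show "cls \<rho> (\<lambda>\<epsilon>. y1 \<epsilon> + y2 \<epsilon>) = cls \<rho> (\<lambda>\<epsilon>. z1 \<epsilon> + z2 \<epsilon>)"
      using a moderate_add[OF g] by (subst cls_eq_iff[OF g]) (auto simp: net_rel_iff add_diff_add)
  qed
  from UN_equiv_class2[OF equiv_net_rel[OF g] equiv_net_rel[OF g] this assms(2,3)]
  show ?thesis by (simp add: RC_def cls_def)
qed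

lemma rc_mult:
  assumes g: "is_gauge \<rho>" and "x \<in> moderate \<rho>" "y \<in> moderate \<rho>"
  shows "cls \<rho> x \<otimes>\<^bsub>RC \<rho>\<^esub> cls \<rho> y = cls \<rho> (\<lambda>\<epsilon>. x \<epsilon> * y \<epsilon>)"
proof -
  have "congruent2 (net_rel \<rho>) (net_rel \<rho>) (\<lambda>x y. cls \<rho> (\<lambda>\<epsilon>. x \<epsilon> * y \<epsilon>))"
  proof (rule congruent2I')
    fix y1 z1 y2 z2 assume a: "(y1, z1) \<in> net_rel \<rho>" "(y2, z2) \<in> net_rel \<rho>"
    have "(\<lambda>\<epsilon>. (y1 \<epsilon> - z1 \<epsilon>) * y2 \<epsilon> + (y2 \<epsilon> - z2 \<epsilon>) * z1 \<epsilon>) \<in> negl \<rho>"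
      using a by (intro negl_add[OF g] negl_mult[OF g]) (auto simp: net_rel_iff)
    then show "cls \<rho> (\<lambda>\<epsilon>. y1 \<epsilon> * y2 \<epsilon>) = cls \<rho> (\<lambda>\<epsilon>. z1 \<epsilon> * z2 \<epsilon>)"
      using a moderate_mult[OF g] by (subst cls_eq_iff[OF g]) (auto simp: net_rel_iff algebra_simps)
  qed
  from UN_equiv_class2[OF equiv_net_rel[OF g] equiv_net_rel[OF g] this assms(2,3)]
  show ?thesis by (simp add: RC_def cls_def)
qed

lemma rc_abs_cls:
  assumes g: "is_gauge \<rho>" and "x \<in> moderate \<rho>"
  shows "rc_abs \<rho> (cls \<rho> x) = cls \<rho> (\<lambda>\<epsilon>. \<bar>x \<epsilon>\<bar>)"
proof -
  have "(\<lambda>x. cls \<rho> (\<lambda>\<epsilon>. \<bar>x \<epsilon>\<bar>)) respects net_rel \<rho>"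
  proof (rule congruentI)
    fix y z assume a: "(y, z) \<in> net_rel \<rho>"
    then have "(\<lambda>\<epsilon>. \<bar>y \<epsilon>\<bar> - \<bar>z \<epsilon>\<bar>) \<in> negl \<rho>"
      by (auto simp: net_rel_iff intro!: always_eventually elim!: negl_mono)
    then show "cls \<rho> (\<lambda>\<epsilon>. \<bar>y \<epsilon>\<bar>) = cls \<rho> (\<lambda>\<epsilon>. \<bar>z \<epsilon>\<bar>)"
      using a by (subst cls_eq_iff[OF g]) (auto simp: net_rel_iff intro: moderate_abs)
  qed
  from UN_equiv_class[OF equiv_net_rel[OF g] this assms(2)]
  show ?thesis by (simp add: rc_abs_def cls_def)
qed

lemma cring_RC: assumes g: "is_gauge \<rho>" shows "cring (RC \<rho>)"
proof (rule cringI)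
  note m = moderate_add[OF g] moderate_mult[OF g] moderate_const[OF g]
  note add = rc_add[OF g] and mult = rc_mult[OF g]
  show "abelian_group (RC \<rho>)"
  proof (rule abelian_groupI)
    show "\<zero>\<^bsub>RC \<rho>\<^esub> \<in> carrier (RC \<rho>)" by (simp add: rc_zero m cls_in_carrier)
  next
    fix X assume "X \<in> carrier (RC \<rho>)"
    then obtain x where x: "x \<in> moderate \<rho>" "X = cls \<rho> x" by (rule carrierE)
    show "\<zero>\<^bsub>RC \<rho>\<^esub> \<oplus>\<^bsub>RC \<rho>\<^esub> X = X" by (simp add: x add rc_zero m)
    have "cls \<rho> (\<lambda>\<epsilon>. - x \<epsilon>) \<oplus>\<^bsub>RC \<rho>\<^esub> X = \<zero>\<^bsub>RC \<rho>\<^esub>"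
      using moderate_minus[OF x(1)] by (simp add: x add rc_zero)
    then show "\<exists>Y\<in>carrier (RC \<rho>). Y \<oplus>\<^bsub>RC \<rho>\<^esub> X = \<zero>\<^bsub>RC \<rho>\<^esub>"
      by (rule bexI) (rule cls_in_carrier[OF moderate_minus[OF x(1)]])
    fix Y assume "Y \<in> carrier (RC \<rho>)"
    then obtain y where y: "y \<in> moderate \<rho>" "Y = cls \<rho> y" by (rule carrierE)
    show "X \<oplus>\<^bsub>RC \<rho>\<^esub> Y \<in> carrier (RC \<rho>)" by (simp add: x y add m cls_in_carrier)
    show "X \<oplus>\<^bsub>RC \<rho>\<^esub> Y = Y \<oplus>\<^bsub>RC \<rho>\<^esub> X" by (simp add: x y add add.commute)
    fix Z assume "Z \<in> carrier (RC \<rho>)"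
    then obtain z where z: "z \<in> moderate \<rho>" "Z = cls \<rho> z" by (rule carrierE)
    show "(X \<oplus>\<^bsub>RC \<rho>\<^esub> Y) \<oplus>\<^bsub>RC \<rho>\<^esub> Z = X \<oplus>\<^bsub>RC \<rho>\<^esub> (Y \<oplus>\<^bsub>RC \<rho>\<^esub> Z)"
      by (simp add: x y z add m add.assoc)
  qed
  show "comm_monoid (RC \<rho>)"
  proof (rule comm_monoidI)
    show "\<one>\<^bsub>RC \<rho>\<^esub> \<in> carrier (RC \<rho>)" by (simp add: rc_one m cls_in_carrier)
  next
    fix X assume "X \<in> carrier (RC \<rho>)"
    then obtain x where x: "x \<in> moderate \<rho>" "X = cls \<rho> x" by (rule carrierE)
    show "\<one>\<^bsub>RC \<rho>\<^esub> \<otimes>\<^bsub>RC \<rho>\<^esub> X = X" by (simp add: x mult rc_one m)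
    fix Y assume "Y \<in> carrier (RC \<rho>)"
    then obtain y where y: "y \<in> moderate \<rho>" "Y = cls \<rho> y" by (rule carrierE)
    show "X \<otimes>\<^bsub>RC \<rho>\<^esub> Y \<in> carrier (RC \<rho>)" by (simp add: x y mult m cls_in_carrier)
    show "X \<otimes>\<^bsub>RC \<rho>\<^esub> Y = Y \<otimes>\<^bsub>RC \<rho>\<^esub> X" by (simp add: x y mult mult.commute)
    fix Z assume "Z \<in> carrier (RC \<rho>)"
    then obtain z where z: "z \<in> moderate \<rho>" "Z = cls \<rho> z" by (rule carrierE)
    show "(X \<otimes>\<^bsub>RC \<rho>\<^esub> Y) \<otimes>\<^bsub>RC \<rho>\<^esub> Z = X \<otimes>\<^bsub>RC \<rho>\<^esub> (Y \<otimes>\<^bsub>RC \<rho>\<^esub> Z)"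
      by (simp add: x y z mult m mult.assoc)
  qed
  fix X Y Z assume "X \<in> carrier (RC \<rho>)" "Y \<in> carrier (RC \<rho>)" "Z \<in> carrier (RC \<rho>)"
  then obtain x y z where "x \<in> moderate \<rho>" "X = cls \<rho> x" "y \<in> moderate \<rho>" "Y = cls \<rho> y"
    "z \<in> moderate \<rho>" "Z = cls \<rho> z" by (meson carrierE)
  then show "(X \<oplus>\<^bsub>RC \<rho>\<^esub> Y) \<otimes>\<^bsub>RC \<rho>\<^esub> Z = X \<otimes>\<^bsub>RC \<rho>\<^esub> Z \<oplus>\<^bsub>RC \<rho>\<^esub> Y \<otimes>\<^bsub>RC \<rho>\<^esub> Z"
    by (simp add: add mult m distrib_right)
qed

lemma rc_minus:
  assumes g: "is_gauge \<rho>" and x: "x \<in> moderate \<rho>" and y: "y \<in> moderate \<rho>"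
  shows "cls \<rho> x \<ominus>\<^bsub>RC \<rho>\<^esub> cls \<rho> y = cls \<rho> (\<lambda>\<epsilon>. x \<epsilon> - y \<epsilon>)"
proof -
  interpret cring "RC \<rho>" by (rule cring_RC[OF g])
  have "cls \<rho> (\<lambda>\<epsilon>. - y \<epsilon>) \<oplus>\<^bsub>RC \<rho>\<^esub> cls \<rho> y = \<zero>\<^bsub>RC \<rho>\<^esub>"
    using y by (simp add: rc_add[OF g] moderate_minus rc_zero)
  then have "\<ominus>\<^bsub>RC \<rho>\<^esub> cls \<rho> y = cls \<rho> (\<lambda>\<epsilon>. - y \<epsilon>)"
    using y by (intro minus_equality) (auto intro!: cls_in_carrier moderate_minus)
  then show ?thesis using x y by (simp add: a_minus_def rc_add[OF g] moderate_minus)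
qed

lemma drho_moderate: assumes g: "is_gauge \<rho>" shows "(\<lambda>\<epsilon>. \<rho> \<epsilon> ^ q) \<in> moderate \<rho>"
proof -
  have "\<forall>\<^sub>F \<epsilon> in at_right 0. \<bar>\<rho> \<epsilon> ^ q\<bar> \<le> 1 / \<rho> \<epsilon> ^ 0"
    using gauge_ev[OF g] by eventually_elim (auto intro: power_le_one)
  then show ?thesis unfolding moderate_def by blast
qed

lemma drho_pow:
  assumes g: "is_gauge \<rho>"
  shows "drho \<rho> [^]\<^bsub>RC \<rho>\<^esub> (q::nat) = cls \<rho> (\<lambda>\<epsilon>. \<rho> \<epsilon> ^ q)"
proof (induction q)
  case 0
  interpret cring "RC \<rho>" by (rule cring_RC[OF g])
  show ?case by (simp add: rc_one)
next
  case (Suc q)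
  interpret cring "RC \<rho>" by (rule cring_RC[OF g])
  show ?case using Suc drho_moderate[OF g, of q] drho_moderate[OF g, of 1]
    by (simp add: drho_def rc_mult[OF g] mult.commute)
qed

lemma cls_self: "is_gauge \<rho> \<Longrightarrow> x \<in> moderate \<rho> \<Longrightarrow> x \<in> cls \<rho> x"
  by (simp add: cls_def net_rel_iff negl_zero)

lemma rc_le_cls:
  assumes g: "is_gauge \<rho>" and x: "x \<in> moderate \<rho>" and y: "y \<in> moderate \<rho>"
  shows "rc_le \<rho> (cls \<rho> x) (cls \<rho> y) \<longleftrightarrow>
    (\<exists>z\<in>negl \<rho>. \<forall>\<^sub>F \<epsilon> in at_right 0. x \<epsilon> \<le> y \<epsilon> + z \<epsilon>)"
proof
  assume "rc_le \<rho> (cls \<rho> x) (cls \<rho> y)"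
  then obtain x' y' z where a: "(\<lambda>\<epsilon>. x \<epsilon> - x' \<epsilon>) \<in> negl \<rho>" "(\<lambda>\<epsilon>. y \<epsilon> - y' \<epsilon>) \<in> negl \<rho>" "z \<in> negl \<rho>"
    and ev: "\<forall>\<^sub>F \<epsilon> in at_right 0. x' \<epsilon> \<le> y' \<epsilon> + z \<epsilon>"
    by (auto simp: rc_le_def cls_def net_rel_iff)
  show "\<exists>z\<in>negl \<rho>. \<forall>\<^sub>F \<epsilon> in at_right 0. x \<epsilon> \<le> y \<epsilon> + z \<epsilon>"
  proof
    show "(\<lambda>\<epsilon>. (x \<epsilon> - x' \<epsilon>) + (- (y \<epsilon> - y' \<epsilon>) + z \<epsilon>)) \<in> negl \<rho>"
      by (intro negl_add[OF g] negl_minus a)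
  qed (use ev in \<open>auto elim: eventually_mono\<close>)
qed (use cls_self[OF g] x y in \<open>auto simp: rc_le_def\<close>)

lemma rc_less_cls:
  assumes g: "is_gauge \<rho>" and x: "x \<in> moderate \<rho>" and y: "y \<in> moderate \<rho>"
  shows "rc_less \<rho> (cls \<rho> x) (cls \<rho> y) \<longleftrightarrow>
    (\<exists>m::nat. \<forall>\<^sub>F \<epsilon> in at_right 0. x \<epsilon> + \<rho> \<epsilon> ^ m \<le> y \<epsilon>)" (is "?L \<longleftrightarrow> ?R")
proof
  let ?d = "\<lambda>\<epsilon>. y \<epsilon> - x \<epsilon>"
  have d: "?d \<in> moderate \<rho>" by (rule moderate_diff[OF g y x])
  {
    assume L: ?L
    then obtain z where z: "z \<in> negl \<rho>" and ez: "\<forall>\<^sub>F \<epsilon> in at_right 0. x \<epsilon> \<le> y \<epsilon> + z \<epsilon>"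
      using rc_le_cls[OF g x y] by (auto simp: rc_less_def)
    from L have "cls \<rho> ?d \<in> Units (RC \<rho>)" by (simp add: rc_less_def rc_minus[OF g y x])
    then obtain W where "W \<in> carrier (RC \<rho>)" "cls \<rho> ?d \<otimes>\<^bsub>RC \<rho>\<^esub> W = \<one>\<^bsub>RC \<rho>\<^esub>"
      by (auto simp: Units_def)
    then obtain w where w: "w \<in> moderate \<rho>" and "cls \<rho> (\<lambda>\<epsilon>. ?d \<epsilon> * w \<epsilon>) = cls \<rho> (\<lambda>\<epsilon>. 1)"
      using d by (auto elim!: carrierE simp: rc_mult[OF g] rc_one)
    then have n: "(\<lambda>\<epsilon>. ?d \<epsilon> * w \<epsilon> - 1) \<in> negl \<rho>"
      using moderate_mult[OF g d w] moderate_const[OF g] by (simp add: cls_eq_iff[OF g])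
    obtain N :: nat where N: "\<forall>\<^sub>F \<epsilon> in at_right 0. \<bar>w \<epsilon>\<bar> \<le> 1 / \<rho> \<epsilon> ^ N" using moderateE[OF w] .
    have "\<forall>\<^sub>F \<epsilon> in at_right 0. \<bar>?d \<epsilon> * w \<epsilon> - 1\<bar> \<le> \<rho> \<epsilon> ^ 1"
      "\<forall>\<^sub>F \<epsilon> in at_right 0. \<bar>z \<epsilon>\<bar> \<le> \<rho> \<epsilon> ^ (N + 2)" using n z unfolding negl_def by blast+
    then have "\<forall>\<^sub>F \<epsilon> in at_right 0. x \<epsilon> + \<rho> \<epsilon> ^ (N + 1) \<le> y \<epsilon>"
      using N ez gauge_ev[OF g] gauge_small[OF g, of "1/2", simplified]
    proof eventually_elim
      case (elim \<epsilon>)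
      have p: "\<rho> \<epsilon> ^ N > 0" using elim by simp
      have "1/2 \<le> \<bar>?d \<epsilon> * w \<epsilon>\<bar>" using elim by simp
      also have "\<dots> \<le> \<bar>?d \<epsilon>\<bar> * (1 / \<rho> \<epsilon> ^ N)"
        unfolding abs_mult using elim by (intro mult_left_mono) auto
      finally have 1: "\<rho> \<epsilon> ^ N * (1/2) \<le> \<bar>?d \<epsilon>\<bar>" using p by (simp add: field_simps)
      have 2: "\<rho> \<epsilon> ^ N * \<rho> \<epsilon> \<le> \<rho> \<epsilon> ^ N * (1/2)" using elim p by (intro mult_left_mono) auto
      have 3: "\<rho> \<epsilon> ^ N * \<rho> \<epsilon> * \<rho> \<epsilon> < \<rho> \<epsilon> ^ N * \<rho> \<epsilon> * 1"
        using elim p by (intro mult_strict_left_mono) auto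
      have 4: "\<rho> \<epsilon> ^ (N + 2) = \<rho> \<epsilon> ^ N * \<rho> \<epsilon> * \<rho> \<epsilon>" "\<rho> \<epsilon> ^ (N + 1) = \<rho> \<epsilon> ^ N * \<rho> \<epsilon>"
        by (simp_all add: power_add power2_eq_square)
      have "- ?d \<epsilon> \<le> \<bar>z \<epsilon>\<bar>" using elim by linarith
      then show ?case using 1 2 3 4 elim by linarith
    qed
    then show ?R by blast
  }
  {
    assume ?R
    then obtain m :: nat where m: "\<forall>\<^sub>F \<epsilon> in at_right 0. x \<epsilon> + \<rho> \<epsilon> ^ m \<le> y \<epsilon>" by blast
    have le: "rc_le \<rho> (cls \<rho> x) (cls \<rho> y)" unfolding rc_le_cls[OF g x y]
    proof
      show "\<forall>\<^sub>F \<epsilon> in at_right 0. x \<epsilon> \<le> y \<epsilon> + 0" using m gauge_ev[OF g]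
      proof eventually_elim
        case (elim \<epsilon>)
        then have "\<rho> \<epsilon> ^ m > 0" by simp
        then show ?case using elim by linarith
      qed
    qed (rule negl_zero[OF g])
    let ?w = "\<lambda>\<epsilon>. 1 / ?d \<epsilon>"
    have ev: "\<forall>\<^sub>F \<epsilon> in at_right 0. \<bar>?w \<epsilon>\<bar> \<le> 1 / \<rho> \<epsilon> ^ m \<and> ?d \<epsilon> * ?w \<epsilon> = 1"
      using m gauge_ev[OF g]
    proof eventually_elim
      case (elim \<epsilon>)
      then have "\<rho> \<epsilon> ^ m > 0" "\<rho> \<epsilon> ^ m \<le> ?d \<epsilon>" by auto
      then show ?case by (auto intro!: divide_left_mono mult_pos_pos simp: abs_if)
    qed
    then have w: "?w \<in> moderate \<rho>" unfolding moderate_def by (auto elim: eventually_mono)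
    have "(\<lambda>\<epsilon>. ?d \<epsilon> * ?w \<epsilon> - 1) \<in> negl \<rho>"
      by (rule negl_mono[OF negl_zero[OF g]]) (use ev in \<open>auto elim: eventually_mono\<close>)
    then have "cls \<rho> (\<lambda>\<epsilon>. ?d \<epsilon> * ?w \<epsilon>) = \<one>\<^bsub>RC \<rho>\<^esub>"
      unfolding rc_one using moderate_mult[OF g d w] moderate_const[OF g] by (subst cls_eq_iff[OF g])
    then have "cls \<rho> ?d \<otimes>\<^bsub>RC \<rho>\<^esub> cls \<rho> ?w = \<one>\<^bsub>RC \<rho>\<^esub>" "cls \<rho> ?w \<otimes>\<^bsub>RC \<rho>\<^esub> cls \<rho> ?d = \<one>\<^bsub>RC \<rho>\<^esub>"
      using d w by (simp_all add: rc_mult[OF g] mult.commute)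
    then have "cls \<rho> ?d \<in> Units (RC \<rho>)"
      using cls_in_carrier[OF d] cls_in_carrier[OF w] by (auto simp: Units_def)
    then show ?L using le by (simp add: rc_less_def rc_minus[OF g y x])
  }
qed

lemma sharp_ball_cls:
  assumes g: "is_gauge \<rho>" and x: "x \<in> moderate \<rho>" and r: "r \<in> moderate \<rho>" and y: "y \<in> moderate \<rho>"
  shows "cls \<rho> y \<in> sharp_ball \<rho> (cls \<rho> x) (cls \<rho> r) \<longleftrightarrow>
    (\<exists>m::nat. \<forall>\<^sub>F \<epsilon> in at_right 0. \<bar>y \<epsilon> - x \<epsilon>\<bar> + \<rho> \<epsilon> ^ m \<le> r \<epsilon>)"
  using assms moderate_diff[OF g y x]
  by (simp add: sharp_ball_def cls_in_carrier rc_minus rc_abs_cls rc_less_cls moderate_abs)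

lemma sharp_ball_drho:
  assumes g: "is_gauge \<rho>" and c: "c \<in> carrier (RC \<rho>)"
  shows "is_sharp_ball \<rho> (sharp_ball \<rho> c (cls \<rho> (\<lambda>\<epsilon>. \<rho> \<epsilon> ^ q)))"
    and "c \<in> sharp_ball \<rho> c (cls \<rho> (\<lambda>\<epsilon>. \<rho> \<epsilon> ^ q))"
proof -
  note d = drho_moderate[OF g, of q]
  have "rc_less \<rho> \<zero>\<^bsub>RC \<rho>\<^esub> (cls \<rho> (\<lambda>\<epsilon>. \<rho> \<epsilon> ^ q))"
    unfolding rc_zero rc_less_cls[OF g moderate_const[OF g] d] by (auto intro!: exI[of _ q])
  then show "is_sharp_ball \<rho> (sharp_ball \<rho> c (cls \<rho> (\<lambda>\<epsilon>. \<rho> \<epsilon> ^ q)))"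
    unfolding is_sharp_ball_def using c cls_in_carrier[OF d] by blast
  show "c \<in> sharp_ball \<rho> c (cls \<rho> (\<lambda>\<epsilon>. \<rho> \<epsilon> ^ q))"
    using c by (elim carrierE) (auto simp: sharp_ball_cls[OF g _ d] intro!: exI[of _ q])
qed

lemma sharp_ball_shrink:
  assumes g: "is_gauge \<rho>" and B: "is_sharp_ball \<rho> B" and c: "c \<in> B"
  obtains q where "\<And>p. p \<ge> q \<Longrightarrow> sharp_ball \<rho> c (cls \<rho> (\<lambda>\<epsilon>. \<rho> \<epsilon> ^ p)) \<subseteq> B"
proof -
  obtain x r where x: "x \<in> moderate \<rho>" and r: "r \<in> moderate \<rho>"
    and BB: "B = sharp_ball \<rho> (cls \<rho> x) (cls \<rho> r)"
    using B by (auto simp: is_sharp_ball_def elim!: carrierE)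
  obtain u where u: "u \<in> moderate \<rho>" "c = cls \<rho> u"
    using c BB by (auto simp: sharp_ball_def elim: carrierE)
  obtain m :: nat where m: "\<forall>\<^sub>F \<epsilon> in at_right 0. \<bar>u \<epsilon> - x \<epsilon>\<bar> + \<rho> \<epsilon> ^ m \<le> r \<epsilon>"
    using c sharp_ball_cls[OF g x r u(1)] by (auto simp: BB u(2))
  have *: "sharp_ball \<rho> c (cls \<rho> (\<lambda>\<epsilon>. \<rho> \<epsilon> ^ p)) \<subseteq> B" if p: "p \<ge> m" for p
  proof
    fix Y assume Y: "Y \<in> sharp_ball \<rho> c (cls \<rho> (\<lambda>\<epsilon>. \<rho> \<epsilon> ^ p))"
    then obtain y where y: "y \<in> moderate \<rho>" "Y = cls \<rho> y" by (auto simp: sharp_ball_def elim: carrierE)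
    then obtain k :: nat where k: "\<forall>\<^sub>F \<epsilon> in at_right 0. \<bar>y \<epsilon> - u \<epsilon>\<bar> + \<rho> \<epsilon> ^ k \<le> \<rho> \<epsilon> ^ p"
      using Y sharp_ball_cls[OF g u(1) drho_moderate[OF g, of p] y(1)] u(2) by auto
    have "\<forall>\<^sub>F \<epsilon> in at_right 0. \<bar>y \<epsilon> - x \<epsilon>\<bar> + \<rho> \<epsilon> ^ k \<le> r \<epsilon>"
      using k m gauge_ev[OF g]
    proof eventually_elim
      case (elim \<epsilon>)
      then have "\<rho> \<epsilon> ^ p \<le> \<rho> \<epsilon> ^ m" using p by (intro power_decreasing) auto
      then show ?case using elim by linarith
    qed
    then show "Y \<in> B" using sharp_ball_cls[OF g x r y(1)] by (auto simp: BB y(2))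
  qed
  show thesis by (rule that[OF *])
qed

lemma istopology_sharp:
  assumes g: "is_gauge \<rho>" shows "istopology (arbitrary union_of is_sharp_ball \<rho>)"
  unfolding istopology_base_eq
proof (intro allI impI)
  fix S T assume ST: "is_sharp_ball \<rho> S \<and> is_sharp_ball \<rho> T"
  have "\<exists>B. is_sharp_ball \<rho> B \<and> c \<in> B \<and> B \<subseteq> S \<inter> T" if c: "c \<in> S \<inter> T" for c
  proof -
    have cc: "c \<in> carrier (RC \<rho>)" using c ST by (auto simp: is_sharp_ball_def sharp_ball_def)
    obtain p where p: "\<And>q. q \<ge> p \<Longrightarrow> sharp_ball \<rho> c (cls \<rho> (\<lambda>\<epsilon>. \<rho> \<epsilon> ^ q)) \<subseteq> S"
      using sharp_ball_shrink[OF g _ , of S c] ST c by (metis IntE)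
    obtain p' where p': "\<And>q. q \<ge> p' \<Longrightarrow> sharp_ball \<rho> c (cls \<rho> (\<lambda>\<epsilon>. \<rho> \<epsilon> ^ q)) \<subseteq> T"
      using sharp_ball_shrink[OF g _ , of T c] ST c by (metis IntE)
    show ?thesis using p[of "max p p'"] p'[of "max p p'"] sharp_ball_drho[OF g cc] by fastforce
  qed
  then show "(arbitrary union_of is_sharp_ball \<rho>) (S \<inter> T)"
    unfolding arbitrary_union_of_alt by blast
qed

lemma openin_sharp_topology:
  "is_gauge \<rho> \<Longrightarrow> openin (sharp_topology \<rho>) = arbitrary union_of is_sharp_ball \<rho>"
  by (simp add: sharp_topology_def istopology_sharp)

lemma topspace_sharp_topology:
  assumes g: "is_gauge \<rho>" shows "topspace (sharp_topology \<rho>) = carrier (RC \<rho>)"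
proof
  show "topspace (sharp_topology \<rho>) \<subseteq> carrier (RC \<rho>)"
    unfolding topspace_def openin_sharp_topology[OF g]
    by (auto simp: arbitrary_union_of_alt is_sharp_ball_def sharp_ball_def)
  show "carrier (RC \<rho>) \<subseteq> topspace (sharp_topology \<rho>)"
  proof
    fix c assume "c \<in> carrier (RC \<rho>)"
    from sharp_ball_drho[OF g this, of 0]
    show "c \<in> topspace (sharp_topology \<rho>)"
      unfolding topspace_def openin_sharp_topology[OF g] by (auto intro: arbitrary_union_of_inc)
  qed
qed

end

(* If f is not continuous at c, some drho^q-ball around f c is missed by f (y p) for points y p of U
   with |y p - c| < drho^p, for every natural p. Only countably many balls are involved, and the classes
   gauge_power sigma p are an increasing cofinal sequence of hypernaturals, whatever the relation
   between sigma and rho. So n |-> y (k n), with k n the first p for which gauge_power sigma (p + 1) <= n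
   fails, is a hypersequence converging to c whose image does not converge to f c. *)
theory Submission
  imports Defs
begin

lemma rc_le_trans:
  assumes g: "is_gauge \<rho>" and c: "X \<in> carrier (RC \<rho>)" "Y \<in> carrier (RC \<rho>)" "Z \<in> carrier (RC \<rho>)"
    and le: "rc_le \<rho> X Y" "rc_le \<rho> Y Z"
  shows "rc_le \<rho> X Z"
proof -
  obtain x y z where x: "x \<in> moderate \<rho>" "X = cls \<rho> x" and y: "y \<in> moderate \<rho>" "Y = cls \<rho> y"
    and z: "z \<in> moderate \<rho>" "Z = cls \<rho> z"
    using c by (meson carrierE)
  obtain u v where u: "u \<in> negl \<rho>" "\<forall>\<^sub>F \<epsilon> in at_right 0. x \<epsilon> \<le> y \<epsilon> + u \<epsilon>"
    and v: "v \<in> negl \<rho>" "\<forall>\<^sub>F \<epsilon> in at_right 0. y \<epsilon> \<le> z \<epsilon> + v \<epsilon>"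
    using le x y z by (auto simp: rc_le_cls[OF g])
  have "\<forall>\<^sub>F \<epsilon> in at_right 0. x \<epsilon> \<le> z \<epsilon> + (u \<epsilon> + v \<epsilon>)"
    using u(2) v(2) by eventually_elim linarith
  then show ?thesis
    using negl_add[OF g u(1) v(1)] x z by (auto simp: rc_le_cls[OF g])
qed

lemma hypernat_carrier: "hypernat \<sigma> \<subseteq> carrier (RC \<sigma>)"
  by (auto simp: hypernat_def intro: cls_in_carrier)

text \<open>This plays the role of the infinite number \<open>drho \<sigma>\<close> to the power -p.
  Rounding up supplies the natural-valued representative that \<open>hypernat\<close>
  demands.\<close>

definition gauge_power :: "net \<Rightarrow> nat \<Rightarrow> net set" where
  "gauge_power \<sigma> p = cls \<sigma> (\<lambda>\<epsilon>. real (nat \<lceil>1 / \<sigma> \<epsilon> ^ p\<rceil>))"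

lemma gauge_power_moderate:
  assumes g: "is_gauge \<sigma>" shows "(\<lambda>\<epsilon>. real (nat \<lceil>1 / \<sigma> \<epsilon> ^ p\<rceil>)) \<in> moderate \<sigma>"
proof -
  have "(\<lambda>\<epsilon>. 1 / \<sigma> \<epsilon> ^ p) \<in> moderate \<sigma>"
    using gauge_ev[OF g] by (auto simp: moderate_def intro!: exI[of _ p] elim!: eventually_mono)
  \<comment> \<open>Rounding up adds at most 1, so this net dominates the rounded one.\<close>
  then have "(\<lambda>\<epsilon>. 1 / \<sigma> \<epsilon> ^ p + 1) \<in> moderate \<sigma>"
    by (rule moderate_add[OF g _ moderate_const[OF g]])
  then obtain N :: nat where "\<forall>\<^sub>F \<epsilon> in at_right 0. \<bar>1 / \<sigma> \<epsilon> ^ p + 1\<bar> \<le> 1 / \<sigma> \<epsilon> ^ N"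
    by (rule moderateE)
  then have "\<forall>\<^sub>F \<epsilon> in at_right 0. \<bar>real (nat \<lceil>1 / \<sigma> \<epsilon> ^ p\<rceil>)\<bar> \<le> 1 / \<sigma> \<epsilon> ^ N"
    using gauge_ev[OF g]
  proof eventually_elim
    case (elim \<epsilon>)
    then have "0 < 1 / \<sigma> \<epsilon> ^ p" by simp
    then have "real (nat \<lceil>1 / \<sigma> \<epsilon> ^ p\<rceil>) \<le> 1 / \<sigma> \<epsilon> ^ p + 1" by linarith
    then show ?case using elim by linarith
  qed
  then show ?thesis unfolding moderate_def by blast
qed

lemma gauge_power_hypernat: "is_gauge \<sigma> \<Longrightarrow> gauge_power \<sigma> p \<in> hypernat \<sigma>"
  using gauge_power_moderate[of \<sigma> p] by (auto simp: gauge_power_def hypernat_def)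

lemma gauge_power_mono:
  assumes g: "is_gauge \<sigma>" and pq: "p \<le> q"
  shows "rc_le \<sigma> (gauge_power \<sigma> p) (gauge_power \<sigma> q)"
  unfolding gauge_power_def rc_le_cls[OF g gauge_power_moderate[OF g] gauge_power_moderate[OF g]]
proof
  show "\<forall>\<^sub>F \<epsilon> in at_right 0. real (nat \<lceil>1 / \<sigma> \<epsilon> ^ p\<rceil>) \<le> real (nat \<lceil>1 / \<sigma> \<epsilon> ^ q\<rceil>) + 0"
    using gauge_ev[OF g]
  proof eventually_elim
    case (elim \<epsilon>)
    then have "1 / \<sigma> \<epsilon> ^ p \<le> 1 / \<sigma> \<epsilon> ^ q"
      using pq by (intro divide_left_mono power_decreasing mult_pos_pos) auto
    then have "nat \<lceil>1 / \<sigma> \<epsilon> ^ p\<rceil> \<le> nat \<lceil>1 / \<sigma> \<epsilon> ^ q\<rceil>"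
      by (intro nat_mono ceiling_mono)
    then show ?case by (simp only: of_nat_le_iff add_0_right)
  qed
qed (rule negl_zero[OF g])

text \<open>A moderate net is eventually bounded by some 1 / \<sigma>^N, and one more factor 1 /
  \<sigma> outgrows that bound by more than any negligible slack. This is the cofinality that lets
  ordinary natural numbers measure the size of hypernaturals; the successor matches the index
  searched for in \<open>hypersequence_tends_to\<close>.\<close>

lemma gauge_power_unbounded:
  assumes g: "is_gauge \<sigma>" and X: "X \<in> carrier (RC \<sigma>)"
  obtains p where "\<not> rc_le \<sigma> (gauge_power \<sigma> (Suc p)) X"
proof -
  obtain x where x: "x \<in> moderate \<sigma>" "X = cls \<sigma> x" using X by (rule carrierE)
  obtain N :: nat where N: "\<forall>\<^sub>F \<epsilon> in at_right 0. \<bar>x \<epsilon>\<bar> \<le> 1 / \<sigma> \<epsilon> ^ N" using moderateE[OF x(1)] .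
  have "\<not> rc_le \<sigma> (gauge_power \<sigma> (Suc N)) X"
  proof
    assume "rc_le \<sigma> (gauge_power \<sigma> (Suc N)) X"
    then obtain z where z: "z \<in> negl \<sigma>"
      and le: "\<forall>\<^sub>F \<epsilon> in at_right 0. real (nat \<lceil>1 / \<sigma> \<epsilon> ^ Suc N\<rceil>) \<le> x \<epsilon> + z \<epsilon>"
      by (auto simp: x(2) gauge_power_def rc_le_cls[OF g gauge_power_moderate[OF g] x(1)]
          simp del: power_Suc)
    \<comment> \<open>Exponent 0 is enough: the slack only has to be at most 1.\<close>
    have "\<forall>\<^sub>F \<epsilon> in at_right 0. \<bar>z \<epsilon>\<bar> \<le> \<sigma> \<epsilon> ^ 0" using z unfolding negl_def by blast
    then have "\<forall>\<^sub>F \<epsilon> in at_right (0::real). False"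
      \<comment> \<open>Write a for 1 / \<sigma>^N, which is at least 1. Once \<sigma> < 1/3, the
        assumed inequality forces 3 a \<le> a + 1, which is impossible.\<close>
      using N le gauge_ev[OF g] gauge_small[OF g, of "1/3", simplified]
    proof eventually_elim
      case (elim \<epsilon>)
      have "1 \<le> 1 / \<sigma> \<epsilon> ^ N" using elim by (simp add: power_le_one)
      moreover have "3 * (1 / \<sigma> \<epsilon> ^ N) \<le> 1 / \<sigma> \<epsilon> * (1 / \<sigma> \<epsilon> ^ N)"
        using elim by (intro mult_right_mono) (auto simp: field_simps)
      moreover have "1 / \<sigma> \<epsilon> * (1 / \<sigma> \<epsilon> ^ N) \<le> real (nat \<lceil>1 / \<sigma> \<epsilon> ^ Suc N\<rceil>)"
        using real_nat_ceiling_ge[of "1 / \<sigma> \<epsilon> ^ Suc N"] by simp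
      moreover have "x \<epsilon> \<le> 1 / \<sigma> \<epsilon> ^ N" "z \<epsilon> \<le> 1" using elim by auto
      ultimately show False using elim by linarith
    qed
    then show False by (simp add: eventually_False trivial_limit_at_right_real)
  qed
  then show thesis by (rule that)
qed

abbreviation drho_ball :: "net \<Rightarrow> net set \<Rightarrow> nat \<Rightarrow> net set set" where
  "drho_ball \<rho> x q \<equiv> sharp_ball \<rho> x (cls \<rho> (\<lambda>\<epsilon>. \<rho> \<epsilon> ^ q))"

lemma drho_ball_antimono:
  assumes g: "is_gauge \<rho>" and c: "c \<in> carrier (RC \<rho>)" and pq: "p \<le> q"
  shows "drho_ball \<rho> c q \<subseteq> drho_ball \<rho> c p"
proof
  fix Y assume Y: "Y \<in> drho_ball \<rho> c q"
  then obtain y where y: "y \<in> moderate \<rho>" "Y = cls \<rho> y" by (auto simp: sharp_ball_def elim: carrierE)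
  obtain u where u: "u \<in> moderate \<rho>" "c = cls \<rho> u" using c by (rule carrierE)
  note ball = sharp_ball_cls[OF g u(1) drho_moderate[OF g] y(1)]
  obtain m :: nat where "\<forall>\<^sub>F \<epsilon> in at_right 0. \<bar>y \<epsilon> - u \<epsilon>\<bar> + \<rho> \<epsilon> ^ m \<le> \<rho> \<epsilon> ^ q"
    using Y by (auto simp: y(2) u(2) ball)
  then have "\<forall>\<^sub>F \<epsilon> in at_right 0. \<bar>y \<epsilon> - u \<epsilon>\<bar> + \<rho> \<epsilon> ^ m \<le> \<rho> \<epsilon> ^ p"
    using gauge_ev[OF g]
  proof eventually_elim
    case (elim \<epsilon>)
    then have "\<rho> \<epsilon> ^ q \<le> \<rho> \<epsilon> ^ p" using pq by (intro power_decreasing) auto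
    then show ?case using elim by linarith
  qed
  then show "Y \<in> drho_ball \<rho> c p" by (auto simp: y(2) u(2) ball)
qed

text \<open>The radii agree by \<open>drho_pow\<close>. A ball also contains the condition of lying
  in the carrier, which the hypothesis on x supplies.\<close>

lemma is_hyperlimit_iff_ball:
  assumes g: "is_gauge \<rho>" and x: "x \<in> hypernat \<sigma> \<rightarrow> carrier (RC \<rho>)" and l: "l \<in> carrier (RC \<rho>)"
  shows "is_hyperlimit \<sigma> \<rho> x l \<longleftrightarrow>
    (\<forall>q. \<exists>M\<in>hypernat \<sigma>. \<forall>n\<in>hypernat \<sigma>. rc_le \<sigma> M n \<longrightarrow> x n \<in> drho_ball \<rho> l q)"
proof -
  have "x n \<in> drho_ball \<rho> l q \<longleftrightarrow>
      rc_less \<rho> (rc_abs \<rho> (x n \<ominus>\<^bsub>RC \<rho>\<^esub> l)) (drho \<rho> [^]\<^bsub>RC \<rho>\<^esub> q)"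
    if "n \<in> hypernat \<sigma>" for n q
    using x that by (auto simp: sharp_ball_def drho_pow[OF g])
  then show ?thesis using l by (simp add: is_hyperlimit_def cong: bex_cong ball_cong)
qed

text \<open>By \<open>sharp_ball_shrink\<close>, a ball contains around each of its points a ball of
  radius some power of \<open>drho \<rho>\<close>. So these countably many radii form a
  neighbourhood base at every point; this first countability is what makes a sequence of
  counterexamples indexed by \<open>nat\<close> sufficient later.\<close>

lemma openin_sharp_iff:
  assumes g: "is_gauge \<rho>"
  shows "openin (sharp_topology \<rho>) W \<longleftrightarrow>
    W \<subseteq> carrier (RC \<rho>) \<and> (\<forall>x\<in>W. \<exists>q. drho_ball \<rho> x q \<subseteq> W)"
proof
  assume W: "openin (sharp_topology \<rho>) W"
  have "\<exists>q. drho_ball \<rho> x q \<subseteq> W" if x: "x \<in> W" for x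
  proof -
    obtain B where B: "is_sharp_ball \<rho> B" "x \<in> B" "B \<subseteq> W"
      using W x unfolding openin_sharp_topology[OF g] arbitrary_union_of_alt by blast
    show ?thesis
    proof (rule sharp_ball_shrink[OF g B(1,2)])
      fix q assume "\<And>p. p \<ge> q \<Longrightarrow> drho_ball \<rho> x p \<subseteq> B"
      from this[of q] B(3) show ?thesis by blast
    qed
  qed
  then show "W \<subseteq> carrier (RC \<rho>) \<and> (\<forall>x\<in>W. \<exists>q. drho_ball \<rho> x q \<subseteq> W)"
    using openin_subset[OF W] topspace_sharp_topology[OF g] by auto
next
  assume R: "W \<subseteq> carrier (RC \<rho>) \<and> (\<forall>x\<in>W. \<exists>q. drho_ball \<rho> x q \<subseteq> W)"
  show "openin (sharp_topology \<rho>) W"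
    unfolding openin_sharp_topology[OF g] arbitrary_union_of_alt
  proof
    fix x assume x: "x \<in> W"
    then obtain q where "drho_ball \<rho> x q \<subseteq> W" using R by blast
    moreover have "x \<in> carrier (RC \<rho>)" using R x by blast
    ultimately show "\<exists>B. is_sharp_ball \<rho> B \<and> x \<in> B \<and> B \<subseteq> W"
      using sharp_ball_drho[OF g, of x q] by blast
  qed
qed

lemma openin_drho_ball:
  assumes g: "is_gauge \<rho>" and c: "c \<in> carrier (RC \<rho>)"
  shows "openin (sharp_topology \<rho>) (drho_ball \<rho> c q)"
  unfolding openin_sharp_topology[OF g] by (intro arbitrary_union_of_inc sharp_ball_drho(1)[OF g c])

text \<open>Continuity can be tested on the countable neighbourhood bases at c and at f c, which
  replaces open sets by two natural exponents.\<close>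

lemma sharply_continuous_at_iff_ball:
  assumes g: "is_gauge \<rho>" and U: "U \<subseteq> carrier (RC \<rho>)" and c: "c \<in> U"
    and f: "f \<in> U \<rightarrow> carrier (RC \<rho>)"
  shows "sharply_continuous_at \<rho> U f c \<longleftrightarrow>
    (\<forall>q. \<exists>p. \<forall>y \<in> U \<inter> drho_ball \<rho> c p. f y \<in> drho_ball \<rho> (f c) q)"
proof
  have fc: "f c \<in> carrier (RC \<rho>)" and cc: "c \<in> carrier (RC \<rho>)" using U c f by auto
  {
    assume L: "sharply_continuous_at \<rho> U f c"
    show "\<forall>q. \<exists>p. \<forall>y \<in> U \<inter> drho_ball \<rho> c p. f y \<in> drho_ball \<rho> (f c) q"
    proof
      fix q
      obtain W where W: "openin (sharp_topology \<rho>) W" "c \<in> W"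
        "\<forall>y \<in> W \<inter> U. f y \<in> drho_ball \<rho> (f c) q"
        using L openin_drho_ball[OF g fc, of q] sharp_ball_drho(2)[OF g fc, of q]
        unfolding sharply_continuous_at_def topcontinuous_at_def openin_subtopology by blast
      then obtain p where "drho_ball \<rho> c p \<subseteq> W" by (auto simp: openin_sharp_iff[OF g])
      then show "\<exists>p. \<forall>y \<in> U \<inter> drho_ball \<rho> c p. f y \<in> drho_ball \<rho> (f c) q" using W(3) by blast
    qed
  }
  {
    assume R: "\<forall>q. \<exists>p. \<forall>y \<in> U \<inter> drho_ball \<rho> c p. f y \<in> drho_ball \<rho> (f c) q"
    have "\<exists>W. openin (subtopology (sharp_topology \<rho>) U) W \<and> c \<in> W \<and> (\<forall>y\<in>W. f y \<in> V)"
      if V: "openin (sharp_topology \<rho>) V" "f c \<in> V" for V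
    proof -
      obtain q where q: "drho_ball \<rho> (f c) q \<subseteq> V" using V by (auto simp: openin_sharp_iff[OF g])
      obtain p where "\<forall>y \<in> U \<inter> drho_ball \<rho> c p. f y \<in> drho_ball \<rho> (f c) q" using R by blast
      then show ?thesis
        \<comment> \<open>The relatively open neighbourhood is the trace on U of the ball around
          c.\<close>
        using openin_subtopology_Int2[OF openin_drho_ball[OF g cc], of U p]
          sharp_ball_drho(2)[OF g cc, of p] c q by blast
    qed
    then show "sharply_continuous_at \<rho> U f c"
      \<comment> \<open>\<open>topcontinuous_at\<close> also requires c to lie in the subspace and f
        to map it into the carrier.\<close>
      using U c f unfolding sharply_continuous_at_def topcontinuous_at_def
      by (simp add: topspace_sharp_topology[OF g] Int_absorb1 cc)
  }
qed

text \<open>An ordinary sequence converging to c at the rate of the powers of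
  \<open>drho \<rho>\<close> is reindexed along a map k from hypernaturals to naturals that
  eventually exceeds every natural number. The gauges interact only through ordinary
  exponents.\<close>

lemma hypersequence_tends_to:
  assumes g: "is_gauge \<rho>" and s: "is_gauge \<sigma>" and c: "c \<in> carrier (RC \<rho>)"
    and y: "\<And>p. y p \<in> drho_ball \<rho> c p"
  obtains k where "is_hyperlimit \<sigma> \<rho> (\<lambda>n. y (k n)) c"
proof
  \<comment> \<open>For a hypernatural n this is the largest p with
    \<open>gauge_power \<sigma> p\<close> below n, and 0 if there is none.\<close>
  define k where "k n = (LEAST p. \<not> rc_le \<sigma> (gauge_power \<sigma> (Suc p)) n)" for n
  \<comment> \<open>\<open>LEAST\<close> gives failure at the single index Suc (k n); monotonicity
    and transitivity carry it to all larger indices.\<close>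
  have k: "p \<le> k n" if n: "n \<in> hypernat \<sigma>" and le: "rc_le \<sigma> (gauge_power \<sigma> p) n" for p n
  proof (rule ccontr)
    assume "\<not> p \<le> k n"
    then have "Suc (k n) \<le> p" by simp
    moreover have "\<not> rc_le \<sigma> (gauge_power \<sigma> (Suc (k n))) n"
    proof -
      obtain m where "\<not> rc_le \<sigma> (gauge_power \<sigma> (Suc m)) n"
        using n hypernat_carrier by (blast intro: gauge_power_unbounded[OF s])
      then show ?thesis unfolding k_def by (rule LeastI)
    qed
    moreover have "gauge_power \<sigma> m \<in> carrier (RC \<sigma>)" for m
      using gauge_power_hypernat[OF s] hypernat_carrier by auto
    ultimately show False
      using rc_le_trans[OF s _ _ _ gauge_power_mono[OF s] le] n hypernat_carrier by auto
  qed
  have "(\<lambda>n. y (k n)) \<in> hypernat \<sigma> \<rightarrow> carrier (RC \<rho>)" using y by (auto simp: sharp_ball_def)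
  \<comment> \<open>The threshold for radius q is \<open>gauge_power \<sigma> q\<close>: beyond it k
    n \<ge> q, and the balls are nested.\<close>
  moreover have "\<forall>n\<in>hypernat \<sigma>. rc_le \<sigma> (gauge_power \<sigma> q) n \<longrightarrow> y (k n) \<in> drho_ball \<rho> c q" for q
    using y drho_ball_antimono[OF g c] k by blast
  ultimately show "is_hyperlimit \<sigma> \<rho> (\<lambda>n. y (k n)) c"
    using gauge_power_hypernat[OF s] is_hyperlimit_iff_ball[OF g _ c] by blast
qed

theorem theorem40:
  fixes \<rho> \<sigma> :: net
    and U :: "net set set"
    and c :: "net set"
    and f :: "net set \<Rightarrow> net set"
  assumes "is_gauge \<rho>" and "is_gauge \<sigma>"
    and "U \<subseteq> carrier (RC \<rho>)" and "c \<in> U" and "f \<in> U \<rightarrow> carrier (RC \<rho>)"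
  shows "sharply_continuous_at \<rho> U f c \<longleftrightarrow> hyper_seq_continuous_at \<sigma> \<rho> U f c"
proof
  have cc: "c \<in> carrier (RC \<rho>)" and fc: "f c \<in> carrier (RC \<rho>)" using assms(3-5) by auto
  note cont = sharply_continuous_at_iff_ball[OF assms(1,3-5)]
  have fx: "(\<lambda>n. f (x n)) \<in> hypernat \<sigma> \<rightarrow> carrier (RC \<rho>)" "x \<in> hypernat \<sigma> \<rightarrow> carrier (RC \<rho>)"
    if "x \<in> hypernat \<sigma> \<rightarrow> U" for x
    using assms(3,5) that by (auto simp: Pi_iff)
  {
    assume L: "sharply_continuous_at \<rho> U f c"
    show "hyper_seq_continuous_at \<sigma> \<rho> U f c"
      unfolding hyper_seq_continuous_at_def
    proof (intro ballI impI)
      fix x assume x: "x \<in> hypernat \<sigma> \<rightarrow> U" and lim: "is_hyperlimit \<sigma> \<rho> x c"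
      show "is_hyperlimit \<sigma> \<rho> (\<lambda>n. f (x n)) (f c)"
        unfolding is_hyperlimit_iff_ball[OF assms(1) fx(1)[OF x] fc]
      proof
        fix q
        obtain p where p: "\<forall>y \<in> U \<inter> drho_ball \<rho> c p. f y \<in> drho_ball \<rho> (f c) q"
          using L cont by blast
        obtain M where "M \<in> hypernat \<sigma>"
          "\<forall>n\<in>hypernat \<sigma>. rc_le \<sigma> M n \<longrightarrow> x n \<in> drho_ball \<rho> c p"
          using lim is_hyperlimit_iff_ball[OF assms(1) fx(2)[OF x] cc] by blast
        then show "\<exists>M\<in>hypernat \<sigma>. \<forall>n\<in>hypernat \<sigma>. rc_le \<sigma> M n \<longrightarrow> f (x n) \<in> drho_ball \<rho> (f c) q"
          using p x by (intro bexI[of _ M]) (auto simp: Pi_iff)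
      qed
    qed
  }
  {
    assume R: "hyper_seq_continuous_at \<sigma> \<rho> U f c"
    show "sharply_continuous_at \<rho> U f c"
    proof (rule ccontr)
      assume "\<not> sharply_continuous_at \<rho> U f c"
      then obtain q where "\<forall>p. \<exists>y \<in> U \<inter> drho_ball \<rho> c p. f y \<notin> drho_ball \<rho> (f c) q"
        unfolding cont by blast
      \<comment> \<open>Countable choice: one bad point for each exponent p, all with the same
        q.\<close>
      then obtain y where y: "\<And>p. y p \<in> U" "\<And>p. y p \<in> drho_ball \<rho> c p"
        "\<And>p. f (y p) \<notin> drho_ball \<rho> (f c) q"
        by (metis IntE)
      obtain k where "is_hyperlimit \<sigma> \<rho> (\<lambda>n. y (k n)) c"
        using hypersequence_tends_to[OF assms(1,2) cc, of y] y(2) by blast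
      moreover have yU: "(\<lambda>n. y (k n)) \<in> hypernat \<sigma> \<rightarrow> U" using y(1) by simp
      ultimately have "is_hyperlimit \<sigma> \<rho> (\<lambda>n. f (y (k n))) (f c)"
        using R unfolding hyper_seq_continuous_at_def by blast
      then obtain M where M: "M \<in> hypernat \<sigma>"
        "\<forall>n\<in>hypernat \<sigma>. rc_le \<sigma> M n \<longrightarrow> f (y (k n)) \<in> drho_ball \<rho> (f c) q"
        using is_hyperlimit_iff_ball[OF assms(1) fx(1)[OF yU] fc] by blast
      \<comment> \<open>Every image f (y p) misses the ball, so a single admissible index is enough
        for the contradiction, and M itself is one.\<close>
      moreover have "rc_le \<sigma> M M"
        using M(1) negl_zero[OF assms(2)] hypernat_carrier
        by (auto simp: hypernat_def rc_le_cls[OF assms(2)] intro!: bexI[of _ "\<lambda>_. 0"])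
      ultimately show False using y(3) by blast
    qed
  }
qed

end
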